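(* Let $\Gamma$ be a finite set of terms and $c$ a term such that $\Gamma\vdash c$ is derivable in OGA. For every assignment $\sigma$ of closed terms to variables, if $h\sigma$ is $\omega$-true for every hypothesis $h\in\Gamma$, then $c\sigma$ is $\omega$-true.
   Context: **Syntax.** Terms: $t::=v_i\mid\bot\mid\mathbf 0\mid\mathbf S t\mid t=t\mid\neg t\mid t\lor t\mid\lambda t\mid t\cdot t\mid\mathcal R\mid\mathcal A$ ($v_i$, $i\in\mathbb N$, de Bruijn variables; $\lambda$ is the only binder; application associates to the left). A term is well-formed (wf) if generated by this grammar; a sentence is a closed wf term when truth is concerned. $\bot$ is a divergent constant, $\mathcal R$ the primitive recursor, $\mathcal A$ the universal quantifier. Abbreviations: $t\,\mathsf N$ is $t=t$; $t\,\mathsf B$ is $t\lor\neg t$; $t\ne u$ is $\neg(t=u)$; $t\land u$ is $\neg(\neg t\lor\neg u)$; $t\to u$ is $\neg t\lor u$; $\underline n=\mathbf S^n\mathbf 0$. $\uparrow$ shifts all free indices up by one; $b[t]$ is the $\beta$-instance substituting $t$ for the outermost bound variable of $b$; $[v\mapsto s]$ is capture-avoiding substitution for a free variable; $\mathrm{fv}$ is the set of free variables. **Head steps** $\triangleright$: $(\lambda b)\cdot t\triangleright b[t]$; $\mathcal R\cdot g\cdot h\cdot\mathbf 0\triangleright g$; $\mathcal R\cdot g\cdot h\cdot(\mathbf S\underline n)\triangleright h\cdot\underline n\cdot(\mathcal R\cdot g\cdot h\cdot\underline n)$; if $t\triangleright t'$ then $t\cdot u\triangleright t'\cdot u$. **Rules.**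 Judgments are $\Gamma\vdash c$, $\Gamma$ a finite set of wf terms, $c$ a wf term (all terms in rules are wf). A proof is a finite list of judgments each following from earlier entries by one rule; $\Gamma\vdash c$ is derivable if it occurs in a proof. Rules ("$\Rightarrow$" from premises to conclusion, "$\Leftrightarrow$" both directions; $\Gamma$ is the context of a judgment when none is shown): $\Gamma,c\vdash c$; $\Gamma\vdash c\Rightarrow\Gamma,a\vdash c$; $\Gamma\vdash a$ and $\Gamma,a\vdash c\Rightarrow\Gamma\vdash c$; $\Gamma\vdash c\Rightarrow[v\mapsto s]\Gamma\vdash[v\mapsto s]c$; $\vdash a\Leftrightarrow\ \vdash a=\underline1$; $\vdash\neg a\Leftrightarrow\ \vdash a=\underline0$; $\vdash\neg a,\ \vdash a\Rightarrow\ \vdash c$; $\vdash a\Leftrightarrow\ \vdash\neg\neg a$; $\vdash a\Rightarrow\ \vdash a\lor b$; $\vdash b\Rightarrow\ \vdash a\lor b$; $\vdash\neg a,\ \vdash\neg b\Rightarrow\ \vdash\neg(a\lor b)$; $\vdash a\lor b,\ \Gamma,a\vdash c,\ \Gamma,b\vdash c\Rightarrow\ \vdash c$; $\vdash\neg(a\lor b)\Rightarrow\ \vdash\neg a$; $\vdash\neg(a\lor b)\Rightarrow\ \vdash\neg b$; $\vdash a\,\mathsf N\Leftrightarrow\ \vdash a=a$; $\vdash a=b\Rightarrow\ \vdash b=a$; $\vdash a=b,\ \vdash[v\mapsto a]p\Rightarrow\ \vdash[v\mapsto b]p$; $\vdash a\ne b\Rightarrow\ \vdash b\ne a$; $\vdash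 a\,\mathsf N,\ \vdash b\,\mathsf N\Rightarrow\ \vdash(a=b)\,\mathsf B$; $\vdash(a=b)\,\mathsf B\Rightarrow\ \vdash(a\,\mathsf N)\land(b\,\mathsf N)$; $\vdash\mathbf 0\,\mathsf N$; $\vdash a\,\mathsf N\Leftrightarrow\ \vdash(\mathbf S a)\,\mathsf N$; $\vdash a\,\mathsf N\Rightarrow\ \vdash\mathbf S a\ne\mathbf 0$; $\vdash a\ne b\Leftrightarrow\ \vdash\mathbf S a\ne\mathbf S b$; $\vdash\mathbf S a=\mathbf S b\Rightarrow\ \vdash a=b$; $\vdash\bot\,\mathsf N\Rightarrow\ \vdash p$; induction: $\vdash[v_i\mapsto\mathbf 0]c$, $\ v_i\,\mathsf N,c,\Gamma\vdash[v_i\mapsto\mathbf S v_i]c$, $\ \vdash a\,\mathsf N\Rightarrow\ \vdash[v_i\mapsto a]c$ if $v_i\notin\mathrm{fv}(\Gamma)$; conversion, for $c\triangleright c'$: $\vdash c'\Rightarrow\ \vdash c$; $\vdash c\Rightarrow\ \vdash c'$; $\vdash\neg c\Rightarrow\ \vdash\neg c'$; $\vdash c'\,\mathsf N\Rightarrow\ \vdash c=c'$; $\vdash m\,\mathsf N,\ \vdash(h\cdot m\cdot(\mathcal R\cdot g\cdot h\cdot m))\,\mathsf N\Rightarrow\ \vdash\mathcal R\cdot g\cdot h\cdot(\mathbf S m)=h\cdot m\cdot(\mathcal R\cdot g\cdot h\cdot m)$; $v_0\,\mathsf N,\uparrow\Gamma\vdash\uparrow f\cdot v_0\Rightarrow\Gamma\vdash\mathcal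 A\cdot f$; $\vdash\mathcal A\cdot f,\ \vdash a\,\mathsf N\Rightarrow\ \vdash f\cdot a$; $\vdash\neg(f\cdot a),\ \vdash a\,\mathsf N\Rightarrow\ \vdash\neg(\mathcal A\cdot f)$; $\Gamma\vdash\neg(\mathcal A\cdot f)$ and $v_0\,\mathsf N,\neg(\uparrow f\cdot v_0),\uparrow\Gamma\vdash\uparrow c\Rightarrow\Gamma\vdash c$. These are the rules of RGA. OGA has these and the rule ATI: $\Gamma\vdash\mathcal A\cdot(\lambda((\uparrow u\cdot v_0)\,\mathsf B))\Rightarrow\Gamma\vdash(\mathcal A\cdot u)\,\mathsf B$. **$\omega$-truth.** Let $\Downarrow$ be the least relation between closed terms and naturals such that: $\mathbf 0\Downarrow0$; $t\Downarrow n$ implies $\mathbf S t\Downarrow n+1$; if $t\Downarrow m$, $u\Downarrow n$ then $(t=u)\Downarrow1$ when $m=n$ and $(t=u)\Downarrow0$ when $m\ne n$; $t\Downarrow1$ implies $\neg t\Downarrow0$, and $t\Downarrow0$ implies $\neg t\Downarrow1$; $t\lor u\Downarrow1$ if $t\Downarrow1$ or $u\Downarrow1$, and $t\lor u\Downarrow0$ if $t\Downarrow0$ and $u\Downarrow0$; for any finite list of arguments $\vec s$: $b[t]\cdot\vec s\Downarrow n$ implies $(\lambda b)\cdot t\cdot\vec s\Downarrow n$; if $a\Downarrow0$ and $g\cdot\vec s\Downarrow n$ then $\mathcal R\cdot g\cdot h\cdot a\cdot\vec s\Downarrow n$; if $a\Downarrow k+1$ and $h\cdot\underline k\cdot(\mathcal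 R\cdot g\cdot h\cdot\underline k)\cdot\vec s\Downarrow n$ then $\mathcal R\cdot g\cdot h\cdot a\cdot\vec s\Downarrow n$; $\mathcal A\cdot f\Downarrow1$ if $f\cdot\underline k\Downarrow1$ for all $k\in\mathbb N$; $\mathcal A\cdot f\Downarrow0$ if $f\cdot\underline k\Downarrow0$ for some $k$. A closed term $t$ is $\omega$-true if $t\Downarrow1$ and $\omega$-false if $t\Downarrow0$. *)

theory Defs
  imports "HOL-Library.FSet"
begin

section \<open>Terms\<close>

text \<open>
  The well-formed terms are exactly the elements of this datatype.  Indices that point
  beyond all enclosing binders are the free variables.
\<close>

datatype trm =
    Var nat
  | Bot
  | Zero
  | Succ trm
  | Eq trm trm (infix \<open>\<doteq>\<close> 60)
  | Neg trm
  | Or trm trm (infixr \<open>\<^bold>\<or>\<close> 55)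
  | Lam trm
  | App trm trm (infixl \<open>\<cdot>\<close> 100)
  | Rec
  | Univ

abbreviation is_N :: "trm \<Rightarrow> trm" where "is_N t \<equiv> t \<doteq> t"

abbreviation is_B :: "trm \<Rightarrow> trm" where "is_B t \<equiv> t \<^bold>\<or> Neg t"

abbreviation Neq :: "trm \<Rightarrow> trm \<Rightarrow> trm" where "Neq t u \<equiv> Neg (t \<doteq> u)"

abbreviation And :: "trm \<Rightarrow> trm \<Rightarrow> trm" where "And t u \<equiv> Neg (Neg t \<^bold>\<or> Neg u)"

abbreviation nml :: "nat \<Rightarrow> trm" where "nml n \<equiv> (Succ ^^ n) Zero"

primrec fv :: "trm \<Rightarrow> nat set" where
  "fv (Var i) = {i}"
| "fv Bot = {}"
| "fv Zero = {}"
| "fv (Succ t) = fv t"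
| "fv (t \<doteq> u) = fv t \<union> fv u"
| "fv (Neg t) = fv t"
| "fv (t \<^bold>\<or> u) = fv t \<union> fv u"
| "fv (Lam b) = {i. Suc i \<in> fv b}"
| "fv (t \<cdot> u) = fv t \<union> fv u"
| "fv Rec = {}"
| "fv Univ = {}"

definition is_closed :: "trm \<Rightarrow> bool" where
  "is_closed t \<longleftrightarrow> fv t = {}"

primrec rename :: "(nat \<Rightarrow> nat) \<Rightarrow> trm \<Rightarrow> trm" where
  "rename r (Var i) = Var (r i)"
| "rename r Bot = Bot"
| "rename r Zero = Zero"
| "rename r (Succ t) = Succ (rename r t)"
| "rename r (t \<doteq> u) = rename r t \<doteq> rename r u"
| "rename r (Neg t) = Neg (rename r t)"
| "rename r (t \<^bold>\<or> u) = rename r t \<^bold>\<or> rename r u"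
| "rename r (Lam b) = Lam (rename (case_nat 0 (\<lambda>i. Suc (r i))) b)"
| "rename r (t \<cdot> u) = rename r t \<cdot> rename r u"
| "rename r Rec = Rec"
| "rename r Univ = Univ"

definition shift :: "trm \<Rightarrow> trm" where
  "shift = rename Suc"

text \<open>
  Simultaneous capture-avoiding substitution for all free variables.  Under a binder, index
  0 is the bound variable and the substituted terms are shifted.
\<close>

primrec psubst :: "(nat \<Rightarrow> trm) \<Rightarrow> trm \<Rightarrow> trm" where
  "psubst s (Var i) = s i"
| "psubst s Bot = Bot"
| "psubst s Zero = Zero"
| "psubst s (Succ t) = Succ (psubst s t)"
| "psubst s (t \<doteq> u) = psubst s t \<doteq> psubst s u"
| "psubst s (Neg t) = Neg (psubst s t)"
| "psubst s (t \<^bold>\<or> u) = psubst s t \<^bold>\<or> psubst s u"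
| "psubst s (Lam b) = Lam (psubst (case_nat (Var 0) (\<lambda>i. shift (s i))) b)"
| "psubst s (t \<cdot> u) = psubst s t \<cdot> psubst s u"
| "psubst s Rec = Rec"
| "psubst s Univ = Univ"

text \<open>
  Substitution for one free variable leaves the other indices alone, whereas the
  \<open>\<beta>\<close>-instance removes a binder and hence lowers them by one.
\<close>

definition subst1 :: "nat \<Rightarrow> trm \<Rightarrow> trm \<Rightarrow> trm" where
  "subst1 v s = psubst (Var(v := s))"

definition beta_inst :: "trm \<Rightarrow> trm \<Rightarrow> trm" where
  "beta_inst b t = psubst (case_nat t Var) b"


section \<open>Derivability\<close>

inductive head_step :: "trm \<Rightarrow> trm \<Rightarrow> bool" (infix \<open>\<rhd>\<close> 50) where
  step_beta: "Lam b \<cdot> t \<rhd> beta_inst b t"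
| step_rec_zero: "Rec \<cdot> g \<cdot> h \<cdot> Zero \<rhd> g"
| step_rec_succ: "Rec \<cdot> g \<cdot> h \<cdot> Succ (nml n) \<rhd> h \<cdot> nml n \<cdot> (Rec \<cdot> g \<cdot> h \<cdot> nml n)"
| step_app: "t \<rhd> t' \<Longrightarrow> t \<cdot> u \<rhd> t' \<cdot> u"

datatype sequent = Entails "trm fset" trm (infix \<open>\<turnstile>\<close> 50)

text \<open>
  \<open>rga_rule P J\<close>: the sequent \<open>J\<close> follows from the set of premises \<open>P\<close> by one application
  of a rule.  The predicate is not recursive.
\<close>

inductive rga_rule :: "sequent set \<Rightarrow> sequent \<Rightarrow> bool" where
  hyp: "rga_rule {} (finsert c \<Gamma> \<turnstile> c)"
| weaken: "rga_rule {\<Gamma> \<turnstile> c} (finsert a \<Gamma> \<turnstile> c)"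
| context_cut: "rga_rule {\<Gamma> \<turnstile> a, finsert a \<Gamma> \<turnstile> c} (\<Gamma> \<turnstile> c)"
| free_subst: "rga_rule {\<Gamma> \<turnstile> c} (subst1 v s |`| \<Gamma> \<turnstile> subst1 v s c)"

| true_eqI: "rga_rule {\<Gamma> \<turnstile> a} (\<Gamma> \<turnstile> a \<doteq> nml 1)"
| true_eqE: "rga_rule {\<Gamma> \<turnstile> a \<doteq> nml 1} (\<Gamma> \<turnstile> a)"
| false_eqI: "rga_rule {\<Gamma> \<turnstile> Neg a} (\<Gamma> \<turnstile> a \<doteq> nml 0)"
| false_eqE: "rga_rule {\<Gamma> \<turnstile> a \<doteq> nml 0} (\<Gamma> \<turnstile> Neg a)"

| explosion: "rga_rule {\<Gamma> \<turnstile> Neg a, \<Gamma> \<turnstile> a} (\<Gamma> \<turnstile> c)"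
| neg_negI: "rga_rule {\<Gamma> \<turnstile> a} (\<Gamma> \<turnstile> Neg (Neg a))"
| neg_negE: "rga_rule {\<Gamma> \<turnstile> Neg (Neg a)} (\<Gamma> \<turnstile> a)"

| orI1: "rga_rule {\<Gamma> \<turnstile> a} (\<Gamma> \<turnstile> a \<^bold>\<or> b)"
| orI2: "rga_rule {\<Gamma> \<turnstile> b} (\<Gamma> \<turnstile> a \<^bold>\<or> b)"
| neg_orI: "rga_rule {\<Gamma> \<turnstile> Neg a, \<Gamma> \<turnstile> Neg b} (\<Gamma> \<turnstile> Neg (a \<^bold>\<or> b))"
| orE: "rga_rule {\<Gamma> \<turnstile> a \<^bold>\<or> b, finsert a \<Gamma> \<turnstile> c, finsert b \<Gamma> \<turnstile> c} (\<Gamma> \<turnstile> c)"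
| neg_orE1: "rga_rule {\<Gamma> \<turnstile> Neg (a \<^bold>\<or> b)} (\<Gamma> \<turnstile> Neg a)"
| neg_orE2: "rga_rule {\<Gamma> \<turnstile> Neg (a \<^bold>\<or> b)} (\<Gamma> \<turnstile> Neg b)"

| natI: "rga_rule {\<Gamma> \<turnstile> a \<doteq> a} (\<Gamma> \<turnstile> is_N a)"
| natE: "rga_rule {\<Gamma> \<turnstile> is_N a} (\<Gamma> \<turnstile> a \<doteq> a)"
| eq_sym: "rga_rule {\<Gamma> \<turnstile> a \<doteq> b} (\<Gamma> \<turnstile> b \<doteq> a)"
| eq_subst: "rga_rule {\<Gamma> \<turnstile> a \<doteq> b, \<Gamma> \<turnstile> subst1 v a p} (\<Gamma> \<turnstile> subst1 v b p)"
| neq_sym: "rga_rule {\<Gamma> \<turnstile> Neq a b} (\<Gamma> \<turnstile> Neq b a)"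
| eq_boolI: "rga_rule {\<Gamma> \<turnstile> is_N a, \<Gamma> \<turnstile> is_N b} (\<Gamma> \<turnstile> is_B (a \<doteq> b))"
| eq_boolE: "rga_rule {\<Gamma> \<turnstile> is_B (a \<doteq> b)} (\<Gamma> \<turnstile> And (is_N a) (is_N b))"

| zero_nat: "rga_rule {} (\<Gamma> \<turnstile> is_N Zero)"
| succ_natI: "rga_rule {\<Gamma> \<turnstile> is_N a} (\<Gamma> \<turnstile> is_N (Succ a))"
| succ_natE: "rga_rule {\<Gamma> \<turnstile> is_N (Succ a)} (\<Gamma> \<turnstile> is_N a)"
| succ_neq_zero: "rga_rule {\<Gamma> \<turnstile> is_N a} (\<Gamma> \<turnstile> Neq (Succ a) Zero)"
| succ_neqI: "rga_rule {\<Gamma> \<turnstile> Neq a b} (\<Gamma> \<turnstile> Neq (Succ a) (Succ b))"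
| succ_neqE: "rga_rule {\<Gamma> \<turnstile> Neq (Succ a) (Succ b)} (\<Gamma> \<turnstile> Neq a b)"
| succ_inj: "rga_rule {\<Gamma> \<turnstile> Succ a \<doteq> Succ b} (\<Gamma> \<turnstile> a \<doteq> b)"
| bot_nat: "rga_rule {\<Gamma> \<turnstile> is_N Bot} (\<Gamma> \<turnstile> p)"
| nat_induction:
    "(\<And>g. g |\<in>| \<Gamma> \<Longrightarrow> i \<notin> fv g) \<Longrightarrow>
     rga_rule
       {\<Gamma> \<turnstile> subst1 i Zero c,
        finsert (is_N (Var i)) (finsert c \<Gamma>) \<turnstile> subst1 i (Succ (Var i)) c,
        \<Gamma> \<turnstile> is_N a}
       (\<Gamma> \<turnstile> subst1 i a c)"

| conv_back: "c \<rhd> c' \<Longrightarrow> rga_rule {\<Gamma> \<turnstile> c'} (\<Gamma> \<turnstile> c)"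
| conv_forw: "c \<rhd> c' \<Longrightarrow> rga_rule {\<Gamma> \<turnstile> c} (\<Gamma> \<turnstile> c')"
| conv_neg: "c \<rhd> c' \<Longrightarrow> rga_rule {\<Gamma> \<turnstile> Neg c} (\<Gamma> \<turnstile> Neg c')"
| conv_eq: "c \<rhd> c' \<Longrightarrow> rga_rule {\<Gamma> \<turnstile> is_N c'} (\<Gamma> \<turnstile> c \<doteq> c')"
| rec_succ:
    "rga_rule
       {\<Gamma> \<turnstile> is_N m, \<Gamma> \<turnstile> is_N (h \<cdot> m \<cdot> (Rec \<cdot> g \<cdot> h \<cdot> m))}
       (\<Gamma> \<turnstile> Rec \<cdot> g \<cdot> h \<cdot> Succ m \<doteq> h \<cdot> m \<cdot> (Rec \<cdot> g \<cdot> h \<cdot> m))"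

| univI:
    "rga_rule {finsert (is_N (Var 0)) (shift |`| \<Gamma>) \<turnstile> shift f \<cdot> Var 0} (\<Gamma> \<turnstile> Univ \<cdot> f)"
| univE: "rga_rule {\<Gamma> \<turnstile> Univ \<cdot> f, \<Gamma> \<turnstile> is_N a} (\<Gamma> \<turnstile> f \<cdot> a)"
| neg_univI: "rga_rule {\<Gamma> \<turnstile> Neg (f \<cdot> a), \<Gamma> \<turnstile> is_N a} (\<Gamma> \<turnstile> Neg (Univ \<cdot> f))"
| neg_univE:
    "rga_rule
       {\<Gamma> \<turnstile> Neg (Univ \<cdot> f),
        finsert (is_N (Var 0)) (finsert (Neg (shift f \<cdot> Var 0)) (shift |`| \<Gamma>)) \<turnstile> shift c}
       (\<Gamma> \<turnstile> c)"

inductive oga_rule :: "sequent set \<Rightarrow> sequent \<Rightarrow> bool" where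
  rga: "rga_rule P J \<Longrightarrow> oga_rule P J"
| ati: "oga_rule {\<Gamma> \<turnstile> Univ \<cdot> Lam (is_B (shift u \<cdot> Var 0))} (\<Gamma> \<turnstile> is_B (Univ \<cdot> u))"

definition oga_proof :: "sequent list \<Rightarrow> bool" where
  "oga_proof Js \<longleftrightarrow>
     (\<forall>i < length Js. \<exists>P. P \<subseteq> set (take i Js) \<and> oga_rule P (Js ! i))"

definition oga_derivable :: "sequent \<Rightarrow> bool" where
  "oga_derivable J \<longleftrightarrow> (\<exists>Js. oga_proof Js \<and> J \<in> set Js)"


section \<open>Truth\<close>

abbreviation apps :: "trm \<Rightarrow> trm list \<Rightarrow> trm" (infixl \<open>\<cdot>\<cdot>\<close> 100) where
  "t \<cdot>\<cdot> ss \<equiv> foldl App t ss"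

text \<open>
  This is a relation on closed terms only.  Closedness is required explicitly in those
  clauses whose premises do not already force it; see \<open>eval_closed\<close> below.
\<close>

inductive eval :: "trm \<Rightarrow> nat \<Rightarrow> bool" (infix \<open>\<Down>\<close> 50) where
  eval_zero: "Zero \<Down> 0"
| eval_succ: "t \<Down> n \<Longrightarrow> Succ t \<Down> n + 1"
| eval_eq_true: "t \<Down> m \<Longrightarrow> u \<Down> n \<Longrightarrow> m = n \<Longrightarrow> (t \<doteq> u) \<Down> 1"
| eval_eq_false: "t \<Down> m \<Longrightarrow> u \<Down> n \<Longrightarrow> m \<noteq> n \<Longrightarrow> (t \<doteq> u) \<Down> 0"
| eval_neg_false: "t \<Down> 1 \<Longrightarrow> Neg t \<Down> 0"
| eval_neg_true: "t \<Down> 0 \<Longrightarrow> Neg t \<Down> 1"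
| eval_or_true1: "t \<Down> 1 \<Longrightarrow> is_closed u \<Longrightarrow> (t \<^bold>\<or> u) \<Down> 1"
| eval_or_true2: "u \<Down> 1 \<Longrightarrow> is_closed t \<Longrightarrow> (t \<^bold>\<or> u) \<Down> 1"
| eval_or_false: "t \<Down> 0 \<Longrightarrow> u \<Down> 0 \<Longrightarrow> (t \<^bold>\<or> u) \<Down> 0"
| eval_beta:
    "beta_inst b t \<cdot>\<cdot> ss \<Down> n \<Longrightarrow> is_closed (Lam b) \<Longrightarrow> is_closed t \<Longrightarrow> Lam b \<cdot> t \<cdot>\<cdot> ss \<Down> n"
| eval_rec_zero:
    "a \<Down> 0 \<Longrightarrow> g \<cdot>\<cdot> ss \<Down> n \<Longrightarrow> is_closed h \<Longrightarrow> Rec \<cdot> g \<cdot> h \<cdot> a \<cdot>\<cdot> ss \<Down> n"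
| eval_rec_succ:
    "a \<Down> k + 1 \<Longrightarrow> h \<cdot> nml k \<cdot> (Rec \<cdot> g \<cdot> h \<cdot> nml k) \<cdot>\<cdot> ss \<Down> n \<Longrightarrow>
     Rec \<cdot> g \<cdot> h \<cdot> a \<cdot>\<cdot> ss \<Down> n"
| eval_univ_true: "(\<And>k. f \<cdot> nml k \<Down> 1) \<Longrightarrow> Univ \<cdot> f \<Down> 1"
| eval_univ_false: "f \<cdot> nml k \<Down> 0 \<Longrightarrow> Univ \<cdot> f \<Down> 0"

lemma fv_apps: "fv (t \<cdot>\<cdot> ss) = fv t \<union> (\<Union>s\<in>set ss. fv s)"
  by (induction ss arbitrary: t) auto

lemma eval_closed: "t \<Down> n \<Longrightarrow> is_closed t"
  by (induction rule: eval.induct) (auto simp: is_closed_def fv_apps)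

definition omega_true :: "trm \<Rightarrow> bool" where
  "omega_true t \<longleftrightarrow> t \<Down> 1"

end

theory Submission
  imports Defs
begin

text \<open>
  Call a sequent valid if every closed instance making its hypotheses \<open>\<omega>\<close>-true makes its
  conclusion \<open>\<omega>\<close>-true; every rule preserves validity.  Two properties of evaluation carry
  the argument.  First, it is deterministic, and a term with a value has no value once it is
  applied to further arguments; both facts come out of one induction, since the recursor branches
  on the value of its argument.  Second, replacing closed subterms by others of the same value
  preserves values: such a subterm cannot occur at the head of a proper application, so the
  replacement commutes with every evaluation clause.  This reduces the rules that mention a term
  \<open>a\<close> with \<open>a N\<close> to the case of a numeral.
\<close>

section \<open>Substitution\<close>

lemma rename_eq_psubst: "rename r t = psubst (\<lambda>i. Var (r i)) t"
proof (induction t arbitrary: r)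
  case (Lam b)
  have "(\<lambda>i. Var (case_nat 0 (\<lambda>i. Suc (r i)) i)) =
      case_nat (Var 0) (\<lambda>i. shift (Var (r i)))"
    by (auto simp: shift_def split: nat.split)
  then show ?case by (simp add: Lam)
qed auto

lemma psubst_rename: "psubst s (rename r t) = psubst (\<lambda>i. s (r i)) t"
proof (induction t arbitrary: r s)
  case (Lam b)
  have "(\<lambda>i. case_nat (Var 0) (\<lambda>i. shift (s i)) (case_nat 0 (\<lambda>i. Suc (r i)) i)) =
      case_nat (Var 0) (\<lambda>i. shift (s (r i)))"
    by (auto split: nat.split)
  then show ?case by (simp add: Lam)
qed auto

lemma psubst_shift: "psubst s (shift t) = psubst (\<lambda>i. s (Suc i)) t"
  by (simp add: shift_def psubst_rename)

lemma rename_rename: "rename q (rename r t) = rename (\<lambda>i. q (r i)) t"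
  by (simp add: rename_eq_psubst[of q] psubst_rename)
     (simp add: rename_eq_psubst)

lemma rename_psubst: "rename r (psubst s t) = psubst (\<lambda>i. rename r (s i)) t"
proof (induction t arbitrary: r s)
  case (Lam b)
  have "(\<lambda>i. rename (case_nat 0 (\<lambda>i. Suc (r i))) (case_nat (Var 0) (\<lambda>i. shift (s i)) i)) =
      case_nat (Var 0) (\<lambda>i. shift (rename r (s i)))"
    by (auto simp: shift_def rename_rename split: nat.split)
  then show ?case by (simp add: Lam)
qed auto

text \<open>Lifting a substitution under a binder shifts its values, so the composite there involves
  both a substitution into a shifted term and a shift of a substituted term. The mixed laws
  \<open>psubst_rename\<close> and \<open>rename_psubst\<close> settle these two and therefore come
  first.\<close>

lemma psubst_psubst: "psubst s (psubst r t) = psubst (\<lambda>i. psubst s (r i)) t"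
proof (induction t arbitrary: r s)
  case (Lam b)
  have "(\<lambda>i. psubst (case_nat (Var 0) (\<lambda>i. shift (s i))) (case_nat (Var 0) (\<lambda>i. shift (r i)) i)) =
      case_nat (Var 0) (\<lambda>i. shift (psubst s (r i)))"
    by (auto simp: psubst_shift[unfolded shift_def] shift_def rename_psubst split: nat.split)
  then show ?case by (simp add: Lam)
qed auto

section \<open>Free variables and closed terms\<close>

lemma psubst_cong: "(\<And>i. i \<in> fv t \<Longrightarrow> s i = r i) \<Longrightarrow> psubst s t = psubst r t"
proof (induction t arbitrary: s r)
  case (Lam b)
  have "case_nat (Var 0) (\<lambda>i. shift (s i)) j = case_nat (Var 0) (\<lambda>i. shift (r i)) j"
    if "j \<in> fv b" for j
    using that Lam.prems by (cases j) auto
  from Lam.IH[OF this] show ?case by simp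
next
  case (Succ t)
  show ?case using Succ.IH[of s r] Succ.prems by simp
next
  case (Eq t u)
  show ?case using Eq.IH[of s r] Eq.prems by simp
next
  case (Neg t)
  show ?case using Neg.IH[of s r] Neg.prems by simp
next
  case (Or t u)
  show ?case using Or.IH[of s r] Or.prems by simp
next
  case (App t u)
  show ?case using App.IH[of s r] App.prems by simp
qed simp_all

lemma psubst_Var: "psubst Var t = t"
proof (induction t)
  case (Lam b)
  have "case_nat (Var 0) (\<lambda>i. shift (Var i)) = Var"
    by (auto simp: shift_def split: nat.split)
  then show ?case by (simp add: Lam)
qed auto

lemma psubst_closed: "is_closed t \<Longrightarrow> psubst s t = t"
  using psubst_cong[of t s Var] by (simp add: psubst_Var is_closed_def)

lemma rename_closed: "is_closed t \<Longrightarrow> rename r t = t"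
  by (simp add: rename_eq_psubst psubst_closed)

lemma shift_closed: "is_closed t \<Longrightarrow> shift t = t"
  by (simp add: shift_def rename_closed)

lemma fv_rename: "fv (rename r t) = r ` fv t"
proof (induction t arbitrary: r)
  case (Lam b)
  show ?case
  proof (intro set_eqI iffI)
    fix i assume "i \<in> fv (rename r (Lam b))"
    then obtain j where "j \<in> fv b" "Suc i = case_nat 0 (\<lambda>i. Suc (r i)) j"
      by (auto simp: Lam)
    then show "i \<in> r ` fv (Lam b)" by (cases j) auto
  next
    fix i assume "i \<in> r ` fv (Lam b)"
    then obtain j where "Suc j \<in> fv b" "i = r j" by auto
    then show "i \<in> fv (rename r (Lam b))" by (auto simp: Lam image_iff intro: bexI[of _ "Suc j"])
  qed
qed auto

lemma fv_psubst: "fv (psubst s t) = (\<Union>i\<in>fv t. fv (s i))"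
proof (induction t arbitrary: s)
  case (Lam b)
  show ?case
  proof (intro set_eqI iffI)
    fix i assume "i \<in> fv (psubst s (Lam b))"
    then obtain j where "j \<in> fv b" "Suc i \<in> fv (case_nat (Var 0) (\<lambda>i. shift (s i)) j)"
      by (auto simp: Lam)
    then show "i \<in> (\<Union>i\<in>fv (Lam b). fv (s i))"
      by (cases j) (auto simp: shift_def fv_rename)
  next
    fix i assume "i \<in> (\<Union>i\<in>fv (Lam b). fv (s i))"
    then obtain j where "Suc j \<in> fv b" "i \<in> fv (s j)" by auto
    then show "i \<in> fv (psubst s (Lam b))"
      by (auto simp: Lam shift_def fv_rename intro!: bexI[of _ "Suc j"])
  qed
qed auto

lemma is_closed_psubst: "(\<And>i. is_closed (\<sigma> i)) \<Longrightarrow> is_closed (psubst \<sigma> t)"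
  by (simp add: is_closed_def fv_psubst)

lemma is_closed_Eq: "is_closed (t \<doteq> u) \<longleftrightarrow> is_closed t \<and> is_closed u"
  by (simp add: is_closed_def)

lemma is_closed_Neg: "is_closed (Neg t) \<longleftrightarrow> is_closed t"
  by (simp add: is_closed_def)

text \<open>Turns a substitution performed by a rule into an update of the assignment, so that a
  premise can be used at the updated assignment.\<close>

lemma psubst_subst1: "psubst \<sigma> (subst1 v s t) = psubst (\<sigma>(v := psubst \<sigma> s)) t"
proof -
  have "(\<lambda>i. psubst \<sigma> ((Var(v := s)) i)) = \<sigma>(v := psubst \<sigma> s)" by auto
  then show ?thesis by (simp add: subst1_def psubst_psubst)
qed

lemma psubst_beta_inst:
  "psubst s (beta_inst b t) =
   beta_inst (psubst (case_nat (Var 0) (\<lambda>i. shift (s i))) b) (psubst s t)"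
proof -
  \<comment> \<open>At index 0 both sides give the instance of \<open>t\<close>; at a successor
    index the outer \<open>case_nat\<close> on the right cancels the shift of the value of
    \<open>s\<close>.\<close>
  have "(\<lambda>i. psubst s (case_nat t Var i)) =
      (\<lambda>i. psubst (case_nat (psubst s t) Var) (case_nat (Var 0) (\<lambda>i. shift (s i)) i))"
    by (auto simp: psubst_shift psubst_Var split: nat.split)
  then show ?thesis by (simp add: beta_inst_def psubst_psubst)
qed

lemma psubst_nml: "psubst s (nml n) = nml n"
  by (induction n) auto

lemma is_closed_nml: "is_closed (nml n)"
  by (induction n) (auto simp: is_closed_def)

lemma psubst_head_step: "c \<rhd> c' \<Longrightarrow> psubst s c \<rhd> psubst s c'"
  by (induction rule: head_step.induct)
     (auto simp: psubst_beta_inst psubst_nml intro: head_step.intros)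


section \<open>Determinism of evaluation\<close>

text \<open>The clauses for \<open>Lam\<close> and \<open>Rec\<close> conclude about a redex
  followed by an argument list of unknown length, which no constructor pattern matches. Splitting
  terms into head and arguments makes such shapes comparable.\<close>

primrec head :: "trm \<Rightarrow> trm" where
  "head (Var i) = Var i"
| "head Bot = Bot"
| "head Zero = Zero"
| "head (Succ t) = Succ t"
| "head (t \<doteq> u) = (t \<doteq> u)"
| "head (Neg t) = Neg t"
| "head (t \<^bold>\<or> u) = (t \<^bold>\<or> u)"
| "head (Lam b) = Lam b"
| "head (t \<cdot> u) = head t"
| "head Rec = Rec"
| "head Univ = Univ"

primrec args :: "trm \<Rightarrow> trm list" where
  "args (Var i) = []"
| "args Bot = []"
| "args Zero = []"
| "args (Succ t) = []"
| "args (t \<doteq> u) = []"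
| "args (Neg t) = []"
| "args (t \<^bold>\<or> u) = []"
| "args (Lam b) = []"
| "args (t \<cdot> u) = args t @ [u]"
| "args Rec = []"
| "args Univ = []"

lemma head_apps [simp]: "head (t \<cdot>\<cdot> ss) = head t"
  by (induction ss arbitrary: t) auto

lemma args_apps [simp]: "args (t \<cdot>\<cdot> ss) = args t @ ss"
  by (induction ss arbitrary: t) auto

lemma apps_head_args: "head t \<cdot>\<cdot> args t = t"
  by (induction t) auto

text \<open>Comparing heads and argument lists decides which clauses can evaluate a given spine;
  each inversion below instantiates this at the spine being inverted.\<close>

lemma trm_eq_iff_head_args: "t = u \<longleftrightarrow> head t = head u \<and> args t = args u"
  by (metis apps_head_args)

section \<open>Inversion of evaluation by the head of the term\<close>

lemma eval_Bot_cases: "Bot \<cdot>\<cdot> ss \<Down> n \<Longrightarrow> False"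
  by (erule eval.cases) (auto simp: trm_eq_iff_head_args[of "Bot \<cdot>\<cdot> ss"])

lemma eval_Zero_cases: "Zero \<cdot>\<cdot> ss \<Down> n \<Longrightarrow> ss = [] \<and> n = 0"
  by (erule eval.cases) (auto simp: trm_eq_iff_head_args[of "Zero \<cdot>\<cdot> ss"])

lemma eval_Succ_cases: "Succ t \<cdot>\<cdot> ss \<Down> n \<Longrightarrow> ss = [] \<and> (\<exists>m. n = m + 1 \<and> t \<Down> m)"
  by (erule eval.cases) (auto simp: trm_eq_iff_head_args[of "Succ t \<cdot>\<cdot> ss"])

lemma eval_Eq_cases:
  "(t \<doteq> u) \<cdot>\<cdot> ss \<Down> n \<Longrightarrow>
   ss = [] \<and> (\<exists>k m. t \<Down> k \<and> u \<Down> m \<and> n = (if k = m then 1 else 0))"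
  by (erule eval.cases) (auto simp: trm_eq_iff_head_args[of "(t \<doteq> u) \<cdot>\<cdot> ss"])

lemma eval_Neg_cases:
  "Neg t \<cdot>\<cdot> ss \<Down> n \<Longrightarrow> ss = [] \<and> (t \<Down> 1 \<and> n = 0 \<or> t \<Down> 0 \<and> n = 1)"
  by (erule eval.cases) (auto simp: trm_eq_iff_head_args[of "Neg t \<cdot>\<cdot> ss"])

lemma eval_Or_cases:
  "(t \<^bold>\<or> u) \<cdot>\<cdot> ss \<Down> n \<Longrightarrow>
   ss = [] \<and> ((t \<Down> 1 \<or> u \<Down> 1) \<and> n = 1 \<or> t \<Down> 0 \<and> u \<Down> 0 \<and> n = 0)"
  by (erule eval.cases) (auto simp: trm_eq_iff_head_args[of "(t \<^bold>\<or> u) \<cdot>\<cdot> ss"])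

text \<open>Every clause with head \<open>Lam\<close> supplies at least one argument, so a bare
  abstraction has no value. Together with the analogues for \<open>Rec\<close> and
  \<open>Univ\<close> this keeps replacement by value away from the head of a redex.\<close>

lemma eval_Lam_args: "Lam b \<cdot>\<cdot> ss \<Down> n \<Longrightarrow> ss \<noteq> []"
  by (erule eval.cases) (auto simp: trm_eq_iff_head_args[of "Lam b \<cdot>\<cdot> ss"])

lemma eval_Rec_args: "Rec \<cdot>\<cdot> ss \<Down> n \<Longrightarrow> ss \<noteq> []"
  by (erule eval.cases) (auto simp: trm_eq_iff_head_args[of "Rec \<cdot>\<cdot> ss"])

lemma eval_Univ_args: "Univ \<cdot>\<cdot> ss \<Down> n \<Longrightarrow> ss \<noteq> []"
  by (erule eval.cases) (auto simp: trm_eq_iff_head_args[of "Univ \<cdot>\<cdot> ss"])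

lemma eval_beta_cases: "Lam b \<cdot> t \<cdot>\<cdot> ss \<Down> n \<Longrightarrow> beta_inst b t \<cdot>\<cdot> ss \<Down> n"
  by (erule eval.cases) (auto simp: trm_eq_iff_head_args[of "Lam b \<cdot> t \<cdot>\<cdot> ss"])

lemma eval_Rec_cases:
  "Rec \<cdot> g \<cdot> h \<cdot> a \<cdot>\<cdot> ss \<Down> n \<Longrightarrow>
   a \<Down> 0 \<and> g \<cdot>\<cdot> ss \<Down> n \<or>
   (\<exists>k. a \<Down> k + 1 \<and> h \<cdot> nml k \<cdot> (Rec \<cdot> g \<cdot> h \<cdot> nml k) \<cdot>\<cdot> ss \<Down> n)"
  by (erule eval.cases) (auto simp: trm_eq_iff_head_args[of "Rec \<cdot> g \<cdot> h \<cdot> a \<cdot>\<cdot> ss"])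

lemma eval_Univ_cases:
  "Univ \<cdot> f \<cdot>\<cdot> ss \<Down> n \<Longrightarrow>
   ss = [] \<and> ((\<forall>k. f \<cdot> nml k \<Down> 1) \<and> n = 1 \<or> (\<exists>k. f \<cdot> nml k \<Down> 0) \<and> n = 0)"
  by (erule eval.cases) (auto simp: trm_eq_iff_head_args[of "Univ \<cdot> f \<cdot>\<cdot> ss"])

text \<open>The list \<open>ss\<close> is arbitrary in the induction because the clauses for
  \<open>Lam\<close> and \<open>Rec\<close> already carry trailing arguments: further ones are
  appended, and the hypothesis for the reduct absorbs them. In the remaining clauses inversion
  excludes surplus arguments, and values are compared through the hypotheses at the empty
  list.\<close>

lemma eval_apps_unique: "t \<Down> n \<Longrightarrow> t \<cdot>\<cdot> ss \<Down> m \<Longrightarrow> ss = [] \<and> m = n"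
proof (induction arbitrary: ss m rule: eval.induct)
  case eval_zero
  then show ?case by (auto dest: eval_Zero_cases)
next
  case (eval_succ t n)
  then show ?case by (force dest!: eval_Succ_cases dest: eval_succ.IH[of "[]", simplified])
next
  case (eval_eq_true t k u l)
  from eval_Eq_cases[OF eval_eq_true.prems] obtain k' l'
    where *: "ss = []" "t \<Down> k'" "u \<Down> l'" "m = (if k' = l' then 1 else 0)" by blast
  have "k' = k" "l' = l" using eval_eq_true.IH(1)[of "[]" k'] eval_eq_true.IH(2)[of "[]" l'] * by auto
  with * eval_eq_true.hyps show ?case by simp
next
  case (eval_eq_false t k u l)
  from eval_Eq_cases[OF eval_eq_false.prems] obtain k' l'
    where *: "ss = []" "t \<Down> k'" "u \<Down> l'" "m = (if k' = l' then 1 else 0)" by blast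
  have "k' = k" "l' = l" using eval_eq_false.IH(1)[of "[]" k'] eval_eq_false.IH(2)[of "[]" l'] * by auto
  with * eval_eq_false.hyps show ?case by simp
next
  case (eval_neg_false t)
  then show ?case by (fastforce dest!: eval_Neg_cases dest: eval_neg_false.IH[of "[]", simplified])
next
  case (eval_neg_true t)
  then show ?case by (fastforce dest!: eval_Neg_cases dest: eval_neg_true.IH[of "[]", simplified])
next
  case (eval_or_true1 t u)
  then show ?case by (fastforce dest!: eval_Or_cases dest: eval_or_true1.IH[of "[]", simplified])
next
  case (eval_or_true2 u t)
  then show ?case by (fastforce dest!: eval_Or_cases dest: eval_or_true2.IH[of "[]", simplified])
next
  case (eval_or_false t u)
  then show ?case
    by (fastforce dest!: eval_Or_cases dest: eval_or_false.IH(1)[of "[]", simplified]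
        eval_or_false.IH(2)[of "[]", simplified])
next
  case (eval_beta b t rs n)
  have "beta_inst b t \<cdot>\<cdot> rs \<cdot>\<cdot> ss \<Down> m"
    using eval_beta_cases[of b t "rs @ ss" m] eval_beta.prems by simp
  then show ?case by (rule eval_beta.IH)
next
  case (eval_rec_zero a g rs n h)
  \<comment> \<open>At the empty list the hypothesis makes 0 the only value of \<open>a\<close>,
    which rules out the successor branch.\<close>
  have "\<not> a \<Down> k + 1" for k using eval_rec_zero.IH(1)[of "[]" "k + 1"] by auto
  then have "g \<cdot>\<cdot> rs \<cdot>\<cdot> ss \<Down> m"
    using eval_Rec_cases[of g h a "rs @ ss" m] eval_rec_zero.prems by auto
  then show ?case by (rule eval_rec_zero.IH)
next
  case (eval_rec_succ a k h g rs n)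
  have "\<not> a \<Down> 0" using eval_rec_succ.IH(1)[of "[]" 0] by auto
  moreover have "l = k" if "a \<Down> l + 1" for l
    using that eval_rec_succ.IH(1)[of "[]" "l + 1"] by auto
  ultimately have "h \<cdot> nml k \<cdot> (Rec \<cdot> g \<cdot> h \<cdot> nml k) \<cdot>\<cdot> rs \<cdot>\<cdot> ss \<Down> m"
    using eval_Rec_cases[of g h a "rs @ ss" m] eval_rec_succ.prems by auto
  then show ?case by (rule eval_rec_succ.IH)
next
  case (eval_univ_true f)
  have "\<not> f \<cdot> nml k \<Down> 0" for k using eval_univ_true.IH[of k "[]" 0] by auto
  then show ?case using eval_Univ_cases eval_univ_true.prems by blast
next
  case (eval_univ_false f k)
  have "\<not> f \<cdot> nml k \<Down> 1" using eval_univ_false.IH[of "[]" 1] by auto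
  then show ?case using eval_Univ_cases eval_univ_false.prems by blast
qed

lemma eval_unique: "t \<Down> n \<Longrightarrow> t \<Down> m \<Longrightarrow> m = n"
  using eval_apps_unique[of t n "[]" m] by simp

lemma eval_nml: "nml n \<Down> n"
  by (induction n) (auto intro: eval.intros eval_succ[where n = n for n, simplified])

section \<open>Truth conditions as equivalences\<close>

lemma Bot_iff: "\<not> Bot \<Down> n"
  using eval_Bot_cases[of "[]"] by auto

lemma Zero_iff: "Zero \<Down> n \<longleftrightarrow> n = 0"
  using eval_Zero_cases[of "[]"] eval_zero by auto

lemma Succ_iff: "Succ t \<Down> n \<longleftrightarrow> (\<exists>m. n = m + 1 \<and> t \<Down> m)"
  using eval_Succ_cases[of t "[]"] eval_succ by auto

text \<open>The value 1 is written \<open>Suc 0\<close> here and below because the simplifier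
  normalises \<open>1\<close> to that form and these equivalences serve as rewrite rules.\<close>

lemma Eq_true_iff: "(t \<doteq> u) \<Down> Suc 0 \<longleftrightarrow> (\<exists>n. t \<Down> n \<and> u \<Down> n)"
  using eval_Eq_cases[of t u "[]"] eval_eq_true by (fastforce split: if_splits)

lemma Eq_false_iff: "(t \<doteq> u) \<Down> 0 \<longleftrightarrow> (\<exists>n m. t \<Down> n \<and> u \<Down> m \<and> n \<noteq> m)"
  using eval_Eq_cases[of t u "[]"] eval_eq_false by (fastforce split: if_splits)

lemma Neg_true_iff: "Neg t \<Down> Suc 0 \<longleftrightarrow> t \<Down> 0"
  using eval_Neg_cases[of t "[]"] eval_neg_true by fastforce

lemma Neg_false_iff: "Neg t \<Down> 0 \<longleftrightarrow> t \<Down> Suc 0"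
  using eval_Neg_cases[of t "[]"] eval_neg_false by fastforce

text \<open>One true disjunct suffices even if the other has no value, but the clauses ask the other
  to be closed; conversely \<open>eval_closed\<close> recovers this from the whole
  disjunction.\<close>

lemma Or_true_iff:
  "(t \<^bold>\<or> u) \<Down> Suc 0 \<longleftrightarrow> (t \<Down> Suc 0 \<and> is_closed u \<or> u \<Down> Suc 0 \<and> is_closed t)"
  using eval_Or_cases[of t u "[]"] eval_or_true1[of t u] eval_or_true2[of u t]
    eval_closed[of "t \<^bold>\<or> u"]
  by (fastforce simp: is_closed_def)

lemma Or_false_iff: "(t \<^bold>\<or> u) \<Down> 0 \<longleftrightarrow> t \<Down> 0 \<and> u \<Down> 0"
  using eval_Or_cases[of t u "[]"] eval_or_false by fastforce

lemma Univ_true_iff: "Univ \<cdot> f \<Down> Suc 0 \<longleftrightarrow> (\<forall>k. f \<cdot> nml k \<Down> Suc 0)"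
  using eval_Univ_cases[of f "[]"] eval_univ_true[of f] by fastforce

lemma Univ_false_iff: "Univ \<cdot> f \<Down> 0 \<longleftrightarrow> (\<exists>k. f \<cdot> nml k \<Down> 0)"
  using eval_Univ_cases[of f "[]"] eval_univ_false[of f] by fastforce

lemmas eval_iffs = Bot_iff Zero_iff Succ_iff Eq_true_iff Eq_false_iff Neg_true_iff Neg_false_iff
  Or_true_iff Or_false_iff Univ_true_iff Univ_false_iff


section \<open>Replacing subterms of equal value\<close>

text \<open>Parallel replacement, also under binders: any number of subterms may be exchanged at
  once, since beta and recursor steps can duplicate them. Terms related by \<open>sim_value\<close>
  have values and hence are closed, so nothing is captured.\<close>

inductive sim :: "trm \<Rightarrow> trm \<Rightarrow> bool" where
  sim_value: "a \<Down> n \<Longrightarrow> b \<Down> n \<Longrightarrow> sim a b"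
| sim_Var: "sim (Var i) (Var i)"
| sim_Bot: "sim Bot Bot"
| sim_Zero: "sim Zero Zero"
| sim_Succ: "sim t t' \<Longrightarrow> sim (Succ t) (Succ t')"
| sim_Eq: "sim t t' \<Longrightarrow> sim u u' \<Longrightarrow> sim (t \<doteq> u) (t' \<doteq> u')"
| sim_Neg: "sim t t' \<Longrightarrow> sim (Neg t) (Neg t')"
| sim_Or: "sim t t' \<Longrightarrow> sim u u' \<Longrightarrow> sim (t \<^bold>\<or> u) (t' \<^bold>\<or> u')"
| sim_Lam: "sim t t' \<Longrightarrow> sim (Lam t) (Lam t')"
| sim_App: "sim t t' \<Longrightarrow> sim u u' \<Longrightarrow> sim (t \<cdot> u) (t' \<cdot> u')"
| sim_Rec: "sim Rec Rec"
| sim_Univ: "sim Univ Univ"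

lemma sim_refl: "sim t t"
  by (induction t) (auto intro: sim.intros)

lemma fv_sim: "sim t u \<Longrightarrow> fv t = fv u"
  by (induction rule: sim.induct) (auto dest!: eval_closed simp: is_closed_def)

lemma sim_closed: "sim t u \<Longrightarrow> is_closed t \<Longrightarrow> is_closed u"
  by (simp add: is_closed_def fv_sim)

lemma sim_rename: "sim t u \<Longrightarrow> sim (rename r t) (rename r u)"
proof (induction arbitrary: r rule: sim.induct)
  case (sim_value a n b)
  then show ?case by (simp add: eval_closed rename_closed sim.sim_value)
qed (auto intro: sim.intros)

text \<open>Terms exchanged by value are closed and thus untouched by substitution. Term and
  substitution vary together because a beta step combines replacements in the body with replacements
  in the argument.\<close>

lemma sim_psubst:
  "sim t u \<Longrightarrow> (\<And>i. sim (s i) (r i)) \<Longrightarrow> sim (psubst s t) (psubst r u)"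
proof (induction arbitrary: s r rule: sim.induct)
  case (sim_value a n b)
  then show ?case by (simp add: eval_closed psubst_closed sim.sim_value)
next
  case (sim_Lam t t')
  then show ?case
    by (auto intro!: sim.sim_Lam sim_Lam.IH sim_rename intro: sim_refl
        simp: shift_def split: nat.split)
qed (auto intro: sim.intros)

lemma sim_beta_inst: "sim b b' \<Longrightarrow> sim t t' \<Longrightarrow> sim (beta_inst b t) (beta_inst b' t')"
  unfolding beta_inst_def by (rule sim_psubst) (auto intro: sim_refl split: nat.split)

lemma sim_apps: "list_all2 sim ss ss' \<Longrightarrow> sim t t' \<Longrightarrow> sim (t \<cdot>\<cdot> ss) (t' \<cdot>\<cdot> ss')"
  by (induction arbitrary: t t' rule: list_all2_induct) (auto intro: sim_App)

text \<open>Peeling arguments off from the right, each application is either related by congruence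
  or is itself the subterm exchanged by value. The value of \<open>u\<close> is recorded only for
  \<open>ss2 = []\<close>, as only then is the whole spine exchanged.\<close>

lemma sim_apps_cases:
  assumes "sim (t \<cdot>\<cdot> ss) u"
  shows "(\<exists>t' ss'. u = t' \<cdot>\<cdot> ss' \<and> sim t t' \<and> list_all2 sim ss ss') \<or>
    (\<exists>ss1 ss2 m. ss = ss1 @ ss2 \<and> t \<cdot>\<cdot> ss1 \<Down> m \<and> (ss2 = [] \<longrightarrow> u \<Down> m))"
  using assms
proof (induction ss arbitrary: u rule: rev_induct)
  case Nil
  then show ?case by (intro disjI1 exI[of _ u] exI[of _ "[]"]) auto
next
  case (snoc s ss)
  from snoc.prems have "sim (t \<cdot>\<cdot> ss \<cdot> s) u" by simp
  then consider (same) m where "t \<cdot>\<cdot> ss \<cdot> s \<Down> m" "u \<Down> m"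
    | (app) v s' where "u = v \<cdot> s'" "sim (t \<cdot>\<cdot> ss) v" "sim s s'"
    by cases auto
  then show ?case
  proof cases
    case same
    then show ?thesis by (intro disjI2 exI[of _ "ss @ [s]"] exI[of _ "[]"]) auto
  next
    case app
    from snoc.IH[OF app(2)] show ?thesis
    proof (elim disjE exE conjE)
      fix t' ss' assume "v = t' \<cdot>\<cdot> ss'" "sim t t'" "list_all2 sim ss ss'"
      then show ?thesis using app
        by (intro disjI1 exI[of _ t'] exI[of _ "ss' @ [s']"]) (auto intro: list_all2_appendI)
    next
      fix ss1 ss2 m assume "ss = ss1 @ ss2" "t \<cdot>\<cdot> ss1 \<Down> m"
      then show ?thesis
        by (intro disjI2 exI[of _ ss1] exI[of _ "ss2 @ [s]"] exI[of _ m]) auto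
    qed
  qed
qed

text \<open>A proper prefix of a spine that has a value cannot have a value itself, by
  \<open>eval_apps_unique\<close>. So an exchange by value along the spine concerns all of
  it.\<close>

lemma sim_eval_apps_cases:
  assumes "t \<cdot>\<cdot> ss \<Down> n" "sim (t \<cdot>\<cdot> ss) u"
  obtains "u \<Down> n" | t' ss' where "u = t' \<cdot>\<cdot> ss'" "sim t t'" "list_all2 sim ss ss'"
  using sim_apps_cases[OF assms(2)]
proof (elim disjE exE conjE)
  fix ss1 ss2 m
  assume *: "ss = ss1 @ ss2" "t \<cdot>\<cdot> ss1 \<Down> m" "ss2 = [] \<longrightarrow> u \<Down> m"
  then have "ss2 = [] \<and> n = m"
    using assms(1) by (intro eval_apps_unique[of "t \<cdot>\<cdot> ss1"]) auto
  with * show thesis using that(1) by auto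
qed (use that in blast)

lemma sim_Lam_cases: "sim (Lam b) u \<Longrightarrow> \<exists>b'. u = Lam b' \<and> sim b b'"
  by (erule sim.cases) (auto dest: eval_Lam_args[where ss = "[]", simplified])

lemma sim_Rec_cases: "sim Rec u \<Longrightarrow> u = Rec"
  by (erule sim.cases) (auto dest: eval_Rec_args[where ss = "[]", simplified])

lemma sim_Univ_cases: "sim Univ u \<Longrightarrow> u = Univ"
  by (erule sim.cases) (auto dest: eval_Univ_args[where ss = "[]", simplified])

text \<open>If the whole term is exchanged by value, uniqueness identifies the common value with
  \<open>n\<close>; otherwise congruence applies. The next three lemmas follow the same
  pattern.\<close>

lemma sim_Succ_cases:
  "Succ t \<Down> n \<Longrightarrow> sim (Succ t) v \<Longrightarrow> v \<Down> n \<or> (\<exists>t'. v = Succ t' \<and> sim t t')"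
  by (erule sim.cases) (auto dest: eval_unique)

lemma sim_Eq_cases:
  "(t \<doteq> u) \<Down> n \<Longrightarrow> sim (t \<doteq> u) v \<Longrightarrow>
   v \<Down> n \<or> (\<exists>t' u'. v = (t' \<doteq> u') \<and> sim t t' \<and> sim u u')"
  by (erule sim.cases) (auto dest: eval_unique)

lemma sim_Neg_cases:
  "Neg t \<Down> n \<Longrightarrow> sim (Neg t) v \<Longrightarrow> v \<Down> n \<or> (\<exists>t'. v = Neg t' \<and> sim t t')"
  by (erule sim.cases) (auto dest: eval_unique)

lemma sim_Or_cases:
  "(t \<^bold>\<or> u) \<Down> n \<Longrightarrow> sim (t \<^bold>\<or> u) v \<Longrightarrow>
   v \<Down> n \<or> (\<exists>t' u'. v = (t' \<^bold>\<or> u') \<and> sim t t' \<and> sim u u')"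
  by (erule sim.cases) (auto dest: eval_unique)

text \<open>In each clause either the whole term is exchanged, and the value carries over, or
  \<open>u\<close> has the same shape with related parts, and the same clause evaluates it by the
  induction hypotheses.\<close>

lemma eval_sim: "t \<Down> n \<Longrightarrow> sim t u \<Longrightarrow> u \<Down> n"
proof (induction arbitrary: u rule: eval.induct)
  case eval_zero
  then show ?case by cases (auto intro: eval.eval_zero dest: eval_unique[OF eval.eval_zero])
next
  case (eval_succ t n)
  then show ?case
    using sim_Succ_cases[OF eval.eval_succ[OF eval_succ.hyps] eval_succ.prems]
    by (blast intro: eval.eval_succ)
next
  case (eval_eq_true t k l m)
  then show ?case
    using sim_Eq_cases[OF eval.eval_eq_true[OF eval_eq_true.hyps] eval_eq_true.prems]
    by (blast intro: eval.eval_eq_true)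
next
  case (eval_eq_false t k l m)
  then show ?case
    using sim_Eq_cases[OF eval.eval_eq_false[OF eval_eq_false.hyps] eval_eq_false.prems]
    by (blast intro: eval.eval_eq_false)
next
  case (eval_neg_false t)
  then show ?case
    using sim_Neg_cases[OF eval.eval_neg_false[OF eval_neg_false.hyps] eval_neg_false.prems]
    by (blast intro: eval.eval_neg_false)
next
  case (eval_neg_true t)
  then show ?case
    using sim_Neg_cases[OF eval.eval_neg_true[OF eval_neg_true.hyps] eval_neg_true.prems]
    by (blast intro: eval.eval_neg_true)
next
  case (eval_or_true1 t l)
  then show ?case
    using sim_Or_cases[OF eval.eval_or_true1[OF eval_or_true1.hyps] eval_or_true1.prems]
    by (blast intro: eval.eval_or_true1 sim_closed)
next
  case (eval_or_true2 l t)
  then show ?case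
    using sim_Or_cases[OF eval.eval_or_true2[OF eval_or_true2.hyps] eval_or_true2.prems]
    by (blast intro: eval.eval_or_true2 sim_closed)
next
  case (eval_or_false t l)
  then show ?case
    using sim_Or_cases[OF eval.eval_or_false[OF eval_or_false.hyps] eval_or_false.prems]
    by (blast intro: eval.eval_or_false)
next
  case (eval_beta b t ss n)
  \<comment> \<open>Counting \<open>t\<close> among the arguments makes the case split speak of the
    head \<open>Lam b\<close>, which is related only to abstractions.\<close>
  have "Lam b \<cdot>\<cdot> (t # ss) \<Down> n" "sim (Lam b \<cdot>\<cdot> (t # ss)) u"
    using eval.eval_beta[OF eval_beta.hyps] eval_beta.prems by auto
  then show ?case
  proof (cases rule: sim_eval_apps_cases)
    case (2 l us)
    then obtain b' t' ss' where u: "u = Lam b' \<cdot> t' \<cdot>\<cdot> ss'"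
      and s: "sim b b'" "sim (Lam b) (Lam b')" "sim t t'" "list_all2 sim ss ss'"
      using sim_Lam_cases[OF 2(2)] by (auto simp: list_all2_Cons1 intro: sim_Lam)
    have "beta_inst b' t' \<cdot>\<cdot> ss' \<Down> n"
      using s by (intro eval_beta.IH sim_apps sim_beta_inst)
    then show ?thesis
      unfolding u using s eval_beta.hyps by (intro eval.eval_beta) (auto intro: sim_closed)
  qed
next
  case (eval_rec_zero a g ss n h)
  have "Rec \<cdot>\<cdot> (g # h # a # ss) \<Down> n" "sim (Rec \<cdot>\<cdot> (g # h # a # ss)) u"
    using eval.eval_rec_zero[OF eval_rec_zero.hyps] eval_rec_zero.prems by auto
  then show ?case
  proof (cases rule: sim_eval_apps_cases)
    case (2 l us)
    then obtain g' h' a' ss' where u: "u = Rec \<cdot> g' \<cdot> h' \<cdot> a' \<cdot>\<cdot> ss'"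
      and s: "sim g g'" "sim h h'" "sim a a'" "list_all2 sim ss ss'"
      using sim_Rec_cases[OF 2(2)] by (auto simp: list_all2_Cons1)
    show ?thesis
      unfolding u using s eval_rec_zero.hyps
      by (intro eval.eval_rec_zero eval_rec_zero.IH sim_apps) (auto intro: sim_closed)
  qed
next
  case (eval_rec_succ a k h g ss n)
  have "Rec \<cdot>\<cdot> (g # h # a # ss) \<Down> n" "sim (Rec \<cdot>\<cdot> (g # h # a # ss)) u"
    using eval.eval_rec_succ[OF eval_rec_succ.hyps] eval_rec_succ.prems by auto
  then show ?case
  proof (cases rule: sim_eval_apps_cases)
    case (2 l us)
    then obtain g' h' a' ss' where u: "u = Rec \<cdot> g' \<cdot> h' \<cdot> a' \<cdot>\<cdot> ss'"
      and s: "sim g g'" "sim h h'" "sim a a'" "list_all2 sim ss ss'"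
      using sim_Rec_cases[OF 2(2)] by (auto simp: list_all2_Cons1)
    \<comment> \<open>By hypothesis \<open>a'\<close> has the same value as \<open>a\<close>, so
      both reducts use the same numeral, which is related to itself.\<close>
    show ?thesis
      unfolding u using s
      by (intro eval.eval_rec_succ[of a' k] eval_rec_succ.IH sim_apps)
         (auto intro!: sim_App intro: sim_refl)
  qed
next
  case (eval_univ_true f)
  have "Univ \<cdot>\<cdot> [f] \<Down> 1" "sim (Univ \<cdot>\<cdot> [f]) u"
    using eval.eval_univ_true[OF eval_univ_true.hyps] eval_univ_true.prems by auto
  then show ?case
  proof (cases rule: sim_eval_apps_cases)
    case (2 l us)
    then obtain f' where "u = Univ \<cdot> f'" "sim f f'"
      using sim_Univ_cases[OF 2(2)] by (auto simp: list_all2_Cons1)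
    moreover from this have "f' \<cdot> nml k \<Down> 1" for k
      by (intro eval_univ_true.IH[of k] sim_App sim_refl)
    ultimately show ?thesis by (blast intro: eval.eval_univ_true)
  qed
next
  case (eval_univ_false f k)
  have "Univ \<cdot>\<cdot> [f] \<Down> 0" "sim (Univ \<cdot>\<cdot> [f]) u"
    using eval.eval_univ_false[OF eval_univ_false.hyps] eval_univ_false.prems by auto
  then show ?case
  proof (cases rule: sim_eval_apps_cases)
    case (2 l us)
    then obtain f' where "u = Univ \<cdot> f'" "sim f f'"
      using sim_Univ_cases[OF 2(2)] by (auto simp: list_all2_Cons1)
    moreover from this have "f' \<cdot> nml k \<Down> 0"
      by (intro eval_univ_false.IH sim_App sim_refl)
    ultimately show ?thesis by (blast intro: eval.eval_univ_false)
  qed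
qed

lemma eval_psubst_update:
  assumes "a \<Down> m" "b \<Down> m" "psubst (\<sigma>(v := a)) p \<Down> n"
  shows "psubst (\<sigma>(v := b)) p \<Down> n"
  using assms(3) by (rule eval_sim) (auto intro!: sim_psubst sim_refl sim_value[OF assms(1,2)])

text \<open>Bridges the quantifier clauses, which test numerals only, and the quantifier rules,
  which speak of any term with a value.\<close>

lemma eval_App_arg: "f \<cdot> a \<Down> n \<Longrightarrow> a \<Down> m \<Longrightarrow> b \<Down> m \<Longrightarrow> f \<cdot> b \<Down> n"
  by (erule eval_sim) (auto intro: sim_App sim_refl sim_value)


section \<open>Conversion\<close>

text \<open>Closedness of \<open>c\<close> is assumed because a step can discard a subterm that the
  clauses require to be closed. The list \<open>ss\<close> is general so that a step in function
  position is covered by moving its argument into the list.\<close>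

lemma eval_head_step_back:
  "c \<rhd> c' \<Longrightarrow> is_closed c \<Longrightarrow> c' \<cdot>\<cdot> ss \<Down> n \<Longrightarrow> c \<cdot>\<cdot> ss \<Down> n"
proof (induction arbitrary: ss rule: head_step.induct)
  case (step_beta b t)
  then show ?case by (auto intro!: eval_beta simp: is_closed_def)
next
  case (step_rec_zero g h)
  then show ?case by (auto intro!: eval_rec_zero eval_zero simp: is_closed_def)
next
  case (step_rec_succ g h k)
  then show ?case by (auto intro!: eval_rec_succ[of _ k] eval_succ[of _ k, simplified] eval_nml)
next
  case (step_app t t' u)
  then show ?case using step_app.IH[of "u # ss"] by (simp add: is_closed_def)
qed

lemma eval_head_step: "c \<rhd> c' \<Longrightarrow> c \<cdot>\<cdot> ss \<Down> n \<Longrightarrow> c' \<cdot>\<cdot> ss \<Down> n"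
proof (induction arbitrary: ss rule: head_step.induct)
  case (step_beta b t)
  then show ?case by (rule eval_beta_cases)
next
  case (step_rec_zero g h)
  then show ?case using eval_unique[OF eval_zero] by (fastforce dest!: eval_Rec_cases)
next
  case (step_rec_succ g h k)
  \<comment> \<open>The numeral has a unique value, which excludes the zero branch and fixes the
    predecessor as \<open>k\<close>.\<close>
  then show ?case
    using eval_unique[OF eval_nml[of "Suc k"]] by (fastforce dest!: eval_Rec_cases)
next
  case (step_app t t' u)
  then show ?case using step_app.IH[of "u # ss"] by simp
qed

lemma eval_head_step_iff: "c \<rhd> c' \<Longrightarrow> is_closed c \<Longrightarrow> c \<Down> n \<longleftrightarrow> c' \<Down> n"
  using eval_head_step[of c c' "[]"] eval_head_step_back[of c c' "[]"] by auto


section \<open>Soundness\<close>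

definition sat :: "(nat \<Rightarrow> trm) \<Rightarrow> trm fset \<Rightarrow> bool" where
  "sat \<sigma> \<Gamma> \<longleftrightarrow> (\<forall>h. h |\<in>| \<Gamma> \<longrightarrow> psubst \<sigma> h \<Down> Suc 0)"

primrec holds :: "(nat \<Rightarrow> trm) \<Rightarrow> sequent \<Rightarrow> bool" where
  "holds \<sigma> (\<Gamma> \<turnstile> c) \<longleftrightarrow> (sat \<sigma> \<Gamma> \<longrightarrow> psubst \<sigma> c \<Down> Suc 0)"

definition valid :: "sequent \<Rightarrow> bool" where
  "valid J \<longleftrightarrow> (\<forall>\<sigma>. (\<forall>i. is_closed (\<sigma> i)) \<longrightarrow> holds \<sigma> J)"

lemma sat_finsert: "sat \<sigma> (finsert a \<Gamma>) \<longleftrightarrow> psubst \<sigma> a \<Down> Suc 0 \<and> sat \<sigma> \<Gamma>"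
  by (auto simp: sat_def)

lemma valid_iff:
  "valid (\<Gamma> \<turnstile> c) \<longleftrightarrow>
     (\<forall>\<sigma>. (\<forall>i. is_closed (\<sigma> i)) \<longrightarrow> (\<forall>h. h |\<in>| \<Gamma> \<longrightarrow> psubst \<sigma> h \<Down> Suc 0) \<longrightarrow>
        psubst \<sigma> c \<Down> Suc 0)"
  by (simp add: valid_def sat_def)

text \<open>An ordinary induction shows \<open>c\<close> at every numeral for the variable
  \<open>i\<close>; \<open>a\<close> has the value of some numeral, and exchanging the two preserves
  truth.\<close>

lemma valid_induction:
  assumes fresh: "\<And>g. g |\<in>| \<Gamma> \<Longrightarrow> i \<notin> fv g"
    and zero: "valid (\<Gamma> \<turnstile> subst1 i Zero c)"
    and step: "valid (finsert (is_N (Var i)) (finsert c \<Gamma>) \<turnstile> subst1 i (Succ (Var i)) c)"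
    and nat: "valid (\<Gamma> \<turnstile> is_N a)"
  shows "valid (\<Gamma> \<turnstile> subst1 i a c)"
  unfolding valid_iff
proof (intro allI impI)
  fix \<sigma> assume cl: "\<forall>i. is_closed (\<sigma> i)" and hyps: "\<forall>h. h |\<in>| \<Gamma> \<longrightarrow> psubst \<sigma> h \<Down> Suc 0"
  have "psubst (\<sigma>(i := nml k)) c \<Down> Suc 0" for k
  proof (induction k)
    case 0
    have "psubst \<sigma> (subst1 i Zero c) \<Down> Suc 0"
      using zero cl hyps unfolding valid_iff by blast
    then show ?case by (simp add: psubst_subst1 fun_upd_def)
  next
    case (Suc k)
    let ?\<sigma> = "\<sigma>(i := nml k)"
    \<comment> \<open>Freshness of \<open>i\<close> keeps the context true when only the value of
      \<open>i\<close> changes.\<close>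
    have "psubst ?\<sigma> h = psubst \<sigma> h" if "h |\<in>| \<Gamma>" for h
      using fresh[OF that] by (intro psubst_cong) auto
    then have "\<forall>h. h |\<in>| finsert (is_N (Var i)) (finsert c \<Gamma>) \<longrightarrow> psubst ?\<sigma> h \<Down> Suc 0"
      using Suc hyps eval_nml by (auto simp: eval_iffs fun_upd_def)
    moreover have "\<forall>j. is_closed (?\<sigma> j)" using cl is_closed_nml by auto
    ultimately have "psubst ?\<sigma> (subst1 i (Succ (Var i)) c) \<Down> Suc 0"
      using step unfolding valid_iff by blast
    then show ?case by (simp add: psubst_subst1 fun_upd_def cong: if_cong)
  qed
  moreover obtain m where "psubst \<sigma> a \<Down> m"
    using nat cl hyps by (auto simp: valid_iff eval_iffs)
  ultimately show "psubst \<sigma> (subst1 i a c) \<Down> Suc 0"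
    unfolding psubst_subst1 by (blast intro: eval_psubst_update eval_nml)
qed

lemma valid_univI:
  assumes "valid (finsert (is_N (Var 0)) (shift |`| \<Gamma>) \<turnstile> shift f \<cdot> Var 0)"
  shows "valid (\<Gamma> \<turnstile> Univ \<cdot> f)"
  unfolding valid_iff
proof (intro allI impI)
  fix \<sigma> assume cl: "\<forall>i. is_closed (\<sigma> i)" and hyps: "\<forall>h. h |\<in>| \<Gamma> \<longrightarrow> psubst \<sigma> h \<Down> Suc 0"
  have "psubst \<sigma> f \<cdot> nml k \<Down> Suc 0" for k
  proof -
    \<comment> \<open>Prepending the numeral interprets the new variable 0 and cancels the shift of
      the context and of \<open>f\<close>.\<close>
    let ?\<sigma> = "case_nat (nml k) \<sigma>"
    have "\<forall>i. is_closed (?\<sigma> i)" using cl is_closed_nml by (auto split: nat.split)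
    moreover have "\<forall>h. h |\<in>| finsert (is_N (Var 0)) (shift |`| \<Gamma>) \<longrightarrow> psubst ?\<sigma> h \<Down> Suc 0"
      using hyps eval_nml by (auto simp: psubst_shift eval_iffs)
    ultimately have "psubst ?\<sigma> (shift f \<cdot> Var 0) \<Down> Suc 0"
      using assms unfolding valid_iff by blast
    then show ?thesis by (simp add: psubst_shift)
  qed
  then show "psubst \<sigma> (Univ \<cdot> f) \<Down> Suc 0" by (simp add: eval_iffs)
qed

text \<open>Falsity of the quantified term yields a numeral counterexample, and this interprets the
  new variable 0 of the second premise.\<close>

lemma valid_neg_univE:
  assumes ex: "valid (\<Gamma> \<turnstile> Neg (Univ \<cdot> f))"
    and wit: "valid (finsert (is_N (Var 0)) (finsert (Neg (shift f \<cdot> Var 0)) (shift |`| \<Gamma>)) \<turnstile> shift c)"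
  shows "valid (\<Gamma> \<turnstile> c)"
  unfolding valid_iff
proof (intro allI impI)
  fix \<sigma> assume cl: "\<forall>i. is_closed (\<sigma> i)" and hyps: "\<forall>h. h |\<in>| \<Gamma> \<longrightarrow> psubst \<sigma> h \<Down> Suc 0"
  then obtain k where k: "psubst \<sigma> f \<cdot> nml k \<Down> 0"
    using ex by (auto simp: valid_iff eval_iffs)
  let ?\<sigma> = "case_nat (nml k) \<sigma>"
  have "\<forall>i. is_closed (?\<sigma> i)" using cl is_closed_nml by (auto split: nat.split)
  moreover have "\<forall>h. h |\<in>| finsert (is_N (Var 0)) (finsert (Neg (shift f \<cdot> Var 0)) (shift |`| \<Gamma>)) \<longrightarrow>
      psubst ?\<sigma> h \<Down> Suc 0"
    using hyps k eval_nml by (auto simp: psubst_shift eval_iffs)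
  ultimately have "psubst ?\<sigma> (shift c) \<Down> Suc 0"
    using wit unfolding valid_iff by blast
  then show "psubst \<sigma> c \<Down> Suc 0" by (simp add: psubst_shift)
qed

lemma valid_rec_succ:
  assumes nat: "valid (\<Gamma> \<turnstile> is_N m)"
    and val: "valid (\<Gamma> \<turnstile> is_N (h \<cdot> m \<cdot> (Rec \<cdot> g \<cdot> h \<cdot> m)))"
  shows "valid (\<Gamma> \<turnstile> Rec \<cdot> g \<cdot> h \<cdot> Succ m \<doteq> h \<cdot> m \<cdot> (Rec \<cdot> g \<cdot> h \<cdot> m))"
  unfolding valid_iff
proof (intro allI impI)
  fix \<sigma> assume \<sigma>: "\<forall>i. is_closed (\<sigma> i)" "\<forall>h. h |\<in>| \<Gamma> \<longrightarrow> psubst \<sigma> h \<Down> Suc 0"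
  let ?m = "psubst \<sigma> m" and ?h = "psubst \<sigma> h" and ?g = "psubst \<sigma> g"
  obtain k where k: "?m \<Down> k" using nat \<sigma> by (auto simp: valid_iff eval_iffs)
  obtain n where n: "?h \<cdot> ?m \<cdot> (Rec \<cdot> ?g \<cdot> ?h \<cdot> ?m) \<Down> n"
    using val \<sigma> by (auto simp: valid_iff eval_iffs)
  \<comment> \<open>The recursor clause unfolds with the numeral for the value of \<open>m\<close>,
    the rule with \<open>m\<close> itself; replacement reconciles them.\<close>
  have "?h \<cdot> nml k \<cdot> (Rec \<cdot> ?g \<cdot> ?h \<cdot> nml k) \<Down> n"
    using n by (rule eval_sim) (auto intro!: sim_App sim_refl sim_value[OF k eval_nml])
  then have "Rec \<cdot> ?g \<cdot> ?h \<cdot> Succ ?m \<Down> n"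
    using eval_rec_succ[of "Succ ?m" k ?h ?g "[]" n] eval_succ[OF k] by simp
  then show "psubst \<sigma> (Rec \<cdot> g \<cdot> h \<cdot> Succ m \<doteq> h \<cdot> m \<cdot> (Rec \<cdot> g \<cdot> h \<cdot> m)) \<Down> Suc 0"
    using n by (auto simp: eval_iffs)
qed

lemma valid_free_subst:
  assumes "valid (\<Gamma> \<turnstile> c)"
  shows "valid (subst1 v s |`| \<Gamma> \<turnstile> subst1 v s c)"
  unfolding valid_iff
proof (intro allI impI)
  fix \<sigma> assume cl: "\<forall>i. is_closed (\<sigma> i)"
    and hyps: "\<forall>h. h |\<in>| subst1 v s |`| \<Gamma> \<longrightarrow> psubst \<sigma> h \<Down> Suc 0"
  let ?\<sigma> = "\<sigma>(v := psubst \<sigma> s)"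
  have "\<forall>i. is_closed (?\<sigma> i)" using cl is_closed_psubst by auto
  moreover have "\<forall>h. h |\<in>| \<Gamma> \<longrightarrow> psubst ?\<sigma> h \<Down> Suc 0"
    using hyps by (auto simp flip: psubst_subst1)
  ultimately show "psubst \<sigma> (subst1 v s c) \<Down> Suc 0"
    using assms unfolding psubst_subst1 valid_iff by blast
qed

lemma psubst_conv:
  assumes "c \<rhd> c'" "\<forall>i. is_closed (\<sigma> i)"
  shows "psubst \<sigma> c \<Down> n \<longleftrightarrow> psubst \<sigma> c' \<Down> n"
  using assms by (intro eval_head_step_iff psubst_head_step is_closed_psubst) auto

text \<open>Most rules keep the assignment and follow from the truth conditions at \<sigma>. Free
  substitution, induction, \<open>univI\<close> and \<open>neg_univE\<close> use premises at other
  assignments, so the premises are also assumed valid.\<close>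

lemma holds_rga_rule:
  assumes "rga_rule P J" "\<forall>i. is_closed (\<sigma> i)" "\<forall>p\<in>P. valid p" "\<forall>p\<in>P. holds \<sigma> p"
  shows "holds \<sigma> J"
proof -
  have cl: "is_closed (psubst \<sigma> t)" for t using assms(2) by (intro is_closed_psubst) auto
  note simps = sat_finsert eval_iffs cl is_closed_Eq is_closed_Neg
  have holds_valid: "holds \<sigma> J'" if "valid J'" for J'
    using that assms(2) by (simp add: valid_def)
  \<comment> \<open>Both directions of exchanging an argument for its numeral: the first provides a
    counterexample for \<open>neg_univI\<close>, the second the instance for
    \<open>univE\<close>.\<close>
  note arg = eval_App_arg[OF _ _ eval_nml] eval_App_arg[OF _ eval_nml]
  show ?thesis using assms(1,3,4)
  proof (induction rule: rga_rule.induct)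
    case (hyp c \<Gamma>)
    then show ?case by (simp add: sat_finsert)
  next
    case (free_subst \<Gamma> c v s)
    show ?case by (rule holds_valid, rule valid_free_subst) (use free_subst in auto)
  next
    case (nat_induction \<Gamma> i c a)
    show ?case by (rule holds_valid, rule valid_induction) (use nat_induction in auto)
  next
    case (rec_succ \<Gamma> m h g)
    show ?case by (rule holds_valid, rule valid_rec_succ) (use rec_succ in auto)
  next
    case (univI \<Gamma> f)
    show ?case by (rule holds_valid, rule valid_univI) (use univI in auto)
  next
    case (neg_univE \<Gamma> f c)
    show ?case by (rule holds_valid, rule valid_neg_univE[of \<Gamma> f]) (use neg_univE in auto)
  next
    case (eq_subst \<Gamma> a b v p)
    then show ?case by (auto simp: psubst_subst1 simps intro: eval_psubst_update)
  next
    case (univE \<Gamma> f a)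
    then show ?case by (auto simp: simps intro: arg)
  next
    case (neg_univI \<Gamma> f a)
    then show ?case by (auto simp: simps intro: arg)
  next
    case (conv_back c c' \<Gamma>)
    then show ?case using assms(2) by (simp add: psubst_conv)
  next
    case (conv_forw c c' \<Gamma>)
    then show ?case using assms(2) by (simp add: psubst_conv)
  next
    case (conv_neg c c' \<Gamma>)
    then show ?case using assms(2) by (simp add: psubst_conv simps)
  next
    case (conv_eq c c' \<Gamma>)
    then show ?case using assms(2) by (simp add: psubst_conv simps)
  next
    case (explosion \<Gamma> a c)
    then show ?case by (auto simp: simps dest: eval_unique)
  qed (auto simp: simps)
qed

lemma valid_rga_rule: "rga_rule P J \<Longrightarrow> \<forall>p\<in>P. valid p \<Longrightarrow> valid J"
  using holds_rga_rule unfolding valid_def by blast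

text \<open>The premise gives every numeral instance of \<open>u\<close> the value 0 or 1.
  Classically, either all are 1 or some is 0, and in both cases the infinitary quantifier clauses
  give \<open>Univ \<cdot> u\<close> a truth value.\<close>

lemma valid_ati:
  assumes "valid (\<Gamma> \<turnstile> Univ \<cdot> Lam (is_B (shift u \<cdot> Var 0)))"
  shows "valid (\<Gamma> \<turnstile> is_B (Univ \<cdot> u))"
  unfolding valid_iff
proof (intro allI impI)
  fix \<sigma> assume \<sigma>: "\<forall>i. is_closed (\<sigma> i)" "\<forall>h. h |\<in>| \<Gamma> \<longrightarrow> psubst \<sigma> h \<Down> Suc 0"
  let ?u = "psubst \<sigma> u"
  have cl: "is_closed ?u" using \<sigma> by (intro is_closed_psubst) auto
  \<comment> \<open>The instance of \<open>u\<close> is closed, so the shift under the binder leaves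
    it unchanged.\<close>
  have "psubst \<sigma> (Lam (is_B (shift u \<cdot> Var 0))) = Lam (is_B (?u \<cdot> Var 0))"
    using \<sigma> by (simp add: psubst_shift shift_closed)
  then have "Lam (is_B (?u \<cdot> Var 0)) \<cdot> nml k \<Down> Suc 0" for k
    using assms \<sigma> by (auto simp: valid_iff eval_iffs)
  from eval_beta_cases[where ss = "[]", simplified, OF this]
  have "?u \<cdot> nml k \<Down> Suc 0 \<or> ?u \<cdot> nml k \<Down> 0" for k
    using cl by (auto simp: beta_inst_def psubst_closed eval_iffs)
  then show "psubst \<sigma> (is_B (Univ \<cdot> u)) \<Down> Suc 0"
    using cl by (auto simp: eval_iffs) (auto simp: is_closed_def)
qed

lemma valid_oga_rule: "oga_rule P J \<Longrightarrow> \<forall>p\<in>P. valid p \<Longrightarrow> valid J"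
  by (induction rule: oga_rule.induct) (auto intro: valid_rga_rule valid_ati)

lemma valid_oga_proof:
  assumes "oga_proof Js" "i < length Js"
  shows "valid (Js ! i)"
  using assms(2)
proof (induction i rule: less_induct)
  case (less i)
  then obtain P where "P \<subseteq> set (take i Js)" "oga_rule P (Js ! i)"
    using assms(1) by (auto simp: oga_proof_def)
  \<comment> \<open>Premises of entry \<open>i\<close> occur strictly earlier in the list, where the
    induction hypothesis applies.\<close>
  moreover have "valid p" if "p \<in> set (take i Js)" for p
    using that less by (auto simp: in_set_conv_nth)
  ultimately show ?case by (blast intro: valid_oga_rule)
qed

theorem theorem4p1:
  fixes \<Gamma> :: "trm fset" and c :: trm and \<sigma> :: "nat \<Rightarrow> trm"
  assumes "oga_derivable (\<Gamma> \<turnstile> c)"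
    and "\<And>i. is_closed (\<sigma> i)"
    and "\<And>h. h |\<in>| \<Gamma> \<Longrightarrow> omega_true (psubst \<sigma> h)"
  shows "omega_true (psubst \<sigma> c)"
proof -
  from assms(1) have "valid (\<Gamma> \<turnstile> c)"
    unfolding oga_derivable_def by (metis in_set_conv_nth valid_oga_proof)
  with assms(2,3) show ?thesis by (simp add: valid_iff omega_true_def)
qed

end
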